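(* Let $P$ be a set of four points in the plane $\mathbb{R}^2$. The rectilinear convex hull of $P$ has positive area if and only if there is a point $p\in\mathbb{R}^2$ such that each of the four open quadrants of $p$ contains a point of $P$.
   Context: An open quadrant is the intersection of two open half-planes, one bounded by a line parallel to the $x$-axis and one bounded by a line parallel to the $y$-axis; its apex is the intersection point of these two lines. The open quadrants of a point $p$ are the four open quadrants with apex $p$. An open quadrant is empty (with respect to $P$) if it contains no point of $P$. The rectilinear convex hull of $P$ is the region obtained by removing from $\mathbb{R}^2$ all empty open quadrants. Area means Lebesgue measure. *)

theory Defs
  imports "HOL-Analysis.Analysis"
begin

definition vertical_half_planes :: "real \<Rightarrow> (real ^ 2) set set" where
  "vertical_half_planes a = {{q. q $ 1 < a}, {q. q $ 1 > a}}"

definition horizontal_half_planes :: "real \<Rightarrow> (real ^ 2) set set" where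
  "horizontal_half_planes b = {{q. q $ 2 < b}, {q. q $ 2 > b}}"

definition open_quadrants :: "real ^ 2 \<Rightarrow> (real ^ 2) set set" where
  "open_quadrants p =
    {V \<inter> H | V H. V \<in> vertical_half_planes (p $ 1) \<and> H \<in> horizontal_half_planes (p $ 2)}"

definition empty_quadrant :: "(real ^ 2) set \<Rightarrow> (real ^ 2) set \<Rightarrow> bool" where
  "empty_quadrant P Q \<longleftrightarrow> (\<exists>p. Q \<in> open_quadrants p) \<and> Q \<inter> P = {}"

definition rectilinear_convex_hull :: "(real ^ 2) set \<Rightarrow> (real ^ 2) set" where
  "rectilinear_convex_hull P = UNIV - \<Union>{Q. empty_quadrant P Q}"

end

theory Submission
  imports Defs
begin

text \<open>
  Let \<open>U\<close> be the set of points all of whose open quadrants meet \<open>P\<close>. It is open, and it is contained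
  in the rectilinear convex hull, because an open quadrant containing \<open>x\<close> contains a quadrant of
  \<open>x\<close>. Conversely, a point of the hull sharing no coordinate with the finitely many points of \<open>P\<close>
  lies in \<open>U\<close>: an empty quadrant of it would stay empty after moving its apex slightly outwards.
  Hence the hull and \<open>U\<close> differ by a subset of finitely many lines, and the hull has positive area
  iff the open set \<open>U\<close> is nonempty.
\<close>

text \<open>Signs \<open>s\<close> and \<open>t\<close> in {-1, 1} select the quadrant, so one
  computation covers all four cases.\<close>

definition quadrant :: "real \<Rightarrow> real \<Rightarrow> real ^ 2 \<Rightarrow> (real ^ 2) set" where
  "quadrant s t p = {q. s * (q $ 1 - p $ 1) > 0 \<and> t * (q $ 2 - p $ 2) > 0}"

lemma open_quadrants_eq:
  "open_quadrants p = {quadrant s t p | s t. s \<in> {-1, 1} \<and> t \<in> {-1, 1}}"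
proof -
  define F :: "real \<Rightarrow> (real ^ 2) set" where "F s = {q. s * (q $ 1 - p $ 1) > 0}" for s
  define G :: "real \<Rightarrow> (real ^ 2) set" where "G t = {q. t * (q $ 2 - p $ 2) > 0}" for t
  have "vertical_half_planes (p $ 1) = F ` {-1, 1}"
    by (simp add: vertical_half_planes_def F_def)
  moreover have "horizontal_half_planes (p $ 2) = G ` {-1, 1}"
    by (simp add: horizontal_half_planes_def G_def)
  moreover have "quadrant s t p = F s \<inter> G t" for s t
    by (auto simp: quadrant_def F_def G_def)
  moreover have "{V \<inter> H | V H. V \<in> F ` S \<and> H \<in> G ` S} = {F s \<inter> G t | s t. s \<in> S \<and> t \<in> S}" for S
    by blast
  ultimately show ?thesis
    by (simp only: open_quadrants_def)
qed

lemma quadrant_subset: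
  assumes "x \<in> quadrant s t p"
  shows "quadrant s t x \<subseteq> quadrant s t p"
  using assms unfolding quadrant_def by (auto simp: algebra_simps)

lemma open_quadrant: "open (quadrant s t p)"
  unfolding quadrant_def by (intro open_Collect_conj open_Collect_less continuous_intros)

text \<open>Trades a condition on the moving apex \<open>x\<close> for membership of
  \<open>x\<close> in a fixed open set, which makes the openness of \<open>quadrant_core\<close>
  visible.\<close>

lemma mem_quadrant_swap: "q \<in> quadrant s t x \<longleftrightarrow> x \<in> quadrant (-s) (-t) q"
  by (auto simp: quadrant_def algebra_simps)

definition quadrant_core :: "(real ^ 2) set \<Rightarrow> (real ^ 2) set" where
  "quadrant_core P = {p. \<forall>Q \<in> open_quadrants p. Q \<inter> P \<noteq> {}}"

lemma open_quadrant_core: "open (quadrant_core P)"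
proof -
  have "quadrant_core P = (\<Inter>s\<in>{-1, 1}. \<Inter>t\<in>{-1, 1}. \<Union>q\<in>P. quadrant (-s) (-t) q)"
  proof (rule set_eqI)
    fix x
    have "x \<in> quadrant_core P \<longleftrightarrow> (\<forall>s\<in>{-1, 1}. \<forall>t\<in>{-1, 1}. \<exists>q\<in>P. q \<in> quadrant s t x)"
      unfolding quadrant_core_def open_quadrants_eq by blast
    also have "\<dots> \<longleftrightarrow> x \<in> (\<Inter>s\<in>{-1, 1}. \<Inter>t\<in>{-1, 1}. \<Union>q\<in>P. quadrant (-s) (-t) q)"
      unfolding mem_quadrant_swap[of _ _ _ x] by blast
    finally show "x \<in> quadrant_core P \<longleftrightarrow> x \<in> (\<Inter>s\<in>{-1, 1}. \<Inter>t\<in>{-1, 1}. \<Union>q\<in>P. quadrant (-s) (-t) q)" .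
  qed
  then show ?thesis
    by (auto intro!: open_INT open_UN open_quadrant)
qed

lemma quadrant_core_subset_hull: "quadrant_core P \<subseteq> rectilinear_convex_hull P"
proof
  fix x assume x: "x \<in> quadrant_core P"
  have "x \<notin> Q" if Q: "empty_quadrant P Q" for Q
  proof
    assume "x \<in> Q"
    obtain p s t where st: "s \<in> {-1, 1}" "t \<in> {-1, 1}" "Q = quadrant s t p"
      using Q by (auto simp: empty_quadrant_def open_quadrants_eq)
    have "quadrant s t x \<inter> P \<noteq> {}"
      using x st by (auto simp: quadrant_core_def open_quadrants_eq)
    moreover have "quadrant s t x \<subseteq> Q"
      using quadrant_subset \<open>x \<in> Q\<close> st by blast
    ultimately show False
      using Q by (auto simp: empty_quadrant_def)
  qed
  then show "x \<in> rectilinear_convex_hull P"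
    by (auto simp: rectilinear_convex_hull_def)
qed

lemma hull_minus_lines_subset_quadrant_core:
  assumes "finite P"
  shows "rectilinear_convex_hull P - (\<Union>q\<in>P. {x. x $ 1 = q $ 1} \<union> {x. x $ 2 = q $ 2}) \<subseteq> quadrant_core P"
proof
  fix x assume x: "x \<in> rectilinear_convex_hull P - (\<Union>q\<in>P. {x. x $ 1 = q $ 1} \<union> {x. x $ 2 = q $ 2})"
  \<comment> \<open>All these distances are positive because \<open>x\<close> avoids the lines
    through \<open>P\<close>; the extra 1 keeps \<open>D\<close> nonempty even for empty
    \<open>P\<close>, so that a minimum exists.\<close>
  define D where "D = insert 1 ((\<lambda>q. \<bar>q $ 1 - x $ 1\<bar>) ` P \<union> (\<lambda>q. \<bar>q $ 2 - x $ 2\<bar>) ` P)"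
  have "finite D" "D \<noteq> {}" "\<forall>d\<in>D. d > 0"
    using assms x by (auto simp: D_def)
  then obtain e where e: "e > 0" "\<forall>d\<in>D. e \<le> d"
    by (metis Min_in Min_le)
  have "quadrant s t x \<inter> P \<noteq> {}" if st: "s \<in> {-1, 1}" "t \<in> {-1, 1}" for s t
  proof -
    \<comment> \<open>Moving the apex by \<open>e\<close> against both signs puts \<open>x\<close>
      itself inside the quadrant, which therefore cannot be empty.\<close>
    define p :: "real ^ 2" where "p = vector [x $ 1 - e * s, x $ 2 - e * t]"
    have p: "p $ 1 = x $ 1 - e * s" "p $ 2 = x $ 2 - e * t"
      by (simp_all add: p_def)
    have "x \<in> quadrant s t p"
      using e st by (auto simp: quadrant_def p)
    moreover have "quadrant s t p \<in> open_quadrants p"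
      using st by (auto simp: open_quadrants_eq)
    ultimately obtain q where q: "q \<in> quadrant s t p" "q \<in> P"
      using x by (auto simp: rectilinear_convex_hull_def empty_quadrant_def)
    have "e \<le> \<bar>q $ 1 - x $ 1\<bar>" "e \<le> \<bar>q $ 2 - x $ 2\<bar>"
      using q e by (auto simp: D_def)
    \<comment> \<open>The signed offset \<open>s * (q $ 1 - x $ 1)\<close> exceeds \<open>-e\<close>
      but has absolute value at least \<open>e\<close>, so it is positive; likewise for the second
      coordinate.\<close>
    then have "q \<in> quadrant s t x"
      using q(1) st e(1) by (auto simp: quadrant_def p)
    then show ?thesis
      using q by blast
  qed
  then show "x \<in> quadrant_core P"
    by (auto simp: quadrant_core_def open_quadrants_eq)
qed

text \<open>Supplies measurability: \<open>emeasure\<close> is 0 by default on non-measurable sets,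
  so only for a measurable hull does measure zero mean negligible.\<close>

lemma closed_rectilinear_convex_hull: "closed (rectilinear_convex_hull P)"
proof -
  have "open Q" if "empty_quadrant P Q" for Q
    using that by (auto simp: empty_quadrant_def open_quadrants_eq open_quadrant)
  then show ?thesis
    unfolding rectilinear_convex_hull_def by (intro closed_Diff open_Union) auto
qed

lemma negligible_hull_iff:
  assumes "finite P"
  shows "negligible (rectilinear_convex_hull P) \<longleftrightarrow> quadrant_core P = {}"
proof
  assume "negligible (rectilinear_convex_hull P)"
  then have "negligible (quadrant_core P)"
    using quadrant_core_subset_hull negligible_subset by blast
  then show "quadrant_core P = {}"
    using open_quadrant_core open_not_negligible by blast
next
  assume "quadrant_core P = {}"
  then have "rectilinear_convex_hull P \<subseteq> (\<Union>q\<in>P. {x. x $ 1 = q $ 1} \<union> {x. x $ 2 = q $ 2})"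
    using hull_minus_lines_subset_quadrant_core[OF assms] by blast
  \<comment> \<open>Written as an inner product with a basis vector, the coordinate equation
    describes a standard hyperplane.\<close>
  moreover have "negligible {x :: real ^ 2. x $ k = a}" for k a
    unfolding cart_eq_inner_axis by (rule negligible_standard_hyperplane) (simp add: axis_in_Basis_iff)
  then have "negligible (\<Union>q\<in>P. {x :: real ^ 2. x $ 1 = q $ 1} \<union> {x. x $ 2 = q $ 2})"
    using assms by (intro negligible_Union) (auto intro!: negligible_Un)
  ultimately show "negligible (rectilinear_convex_hull P)"
    by (rule negligible_subset[rotated])
qed

theorem lemma1:
  fixes P :: "(real ^ 2) set"
  assumes "card P = 4"
  shows "emeasure lebesgue (rectilinear_convex_hull P) > 0 \<longleftrightarrow>
         (\<exists>p. \<forall>Q \<in> open_quadrants p. Q \<inter> P \<noteq> {})"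
proof -
  have "finite P"
    \<comment> \<open>An infinite set has \<open>card\<close> 0, so cardinality 4 forces
      finiteness.\<close>
    using assms by (intro card_ge_0_finite) simp
  have "rectilinear_convex_hull P \<in> sets lebesgue"
    by (simp add: closed_rectilinear_convex_hull borel_closed)
  then have "emeasure lebesgue (rectilinear_convex_hull P) > 0 \<longleftrightarrow> \<not> negligible (rectilinear_convex_hull P)"
    by (simp add: negligible_iff_null_sets null_sets_def zero_less_iff_neq_zero)
  then show ?thesis
    using negligible_hull_iff[OF \<open>finite P\<close>] by (auto simp: quadrant_core_def)
qed

end
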